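(* For every positive integer $m$ we have $|R_{m+1}-R_m|\le 144$.
   Context: For a positive integer $m$ let $\mathbb{Z}_m=\mathbb{Z}/m\mathbb{Z}$. For $\mathcal{A}\subseteq \mathbb{Z}_m$ and $n\in\mathbb{Z}_m$ put $\sigma_{\mathcal{A}}(n)=\#\{(a,a')\in\mathcal{A}^2: a+a'\equiv n \pmod m\}$ (ordered pairs). The Ruzsa number $R_m$ is the least integer $r$ such that there is a subset $\mathcal{A}\subseteq\mathbb{Z}_m$ with $1\le \sigma_{\mathcal{A}}(n)\le r$ for all $n\in\mathbb{Z}_m$. *)

theory Defs
  imports "HOL-Number_Theory.Cong"
begin

(* The residue ring Z/mZ is represented by the residues {0..<m}; equality in Z/mZ is
   congruence modulo m. *)

definition rep_count :: "nat \<Rightarrow> nat set \<Rightarrow> nat \<Rightarrow> nat" where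
  "rep_count m A n = card {(a, a'). a \<in> A \<and> a' \<in> A \<and> [a + a' = n] (mod m)}"

definition ruzsa_number :: "nat \<Rightarrow> nat" where
  "ruzsa_number m =
    (LEAST r. \<exists>A \<subseteq> {0..<m}. \<forall>n \<in> {0..<m}. 1 \<le> rep_count m A n \<and> rep_count m A n \<le> r)"

(* The set whose least element is taken is nonempty for every positive m, so the least
   element is a genuine one. *)

lemma ruzsa_number_bound_exists:
  assumes "m > 0"
  shows "\<exists>r. \<exists>A \<subseteq> {0..<m}. \<forall>n \<in> {0..<m}. 1 \<le> rep_count m A n \<and> rep_count m A n \<le> r"
proof (intro exI[of _ "m * m"] exI[of _ "{0..<m}"] conjI ballI)
  fix n assume n: "n \<in> {0..<m}"
  let ?S = "{(a, a'). a \<in> {0..<m} \<and> a' \<in> {0..<m} \<and> [a + a' = n] (mod m)}"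
  have sub: "?S \<subseteq> {0..<m} \<times> {0..<m}"
    by auto
  have "(0, n) \<in> ?S"
    using n by auto
  then have "card ?S > 0"
    using finite_subset[OF sub] by (auto simp only: card_gt_0_iff finite_cartesian_product finite_atLeastLessThan)
  then show "1 \<le> rep_count m {0..<m} n"
    unfolding rep_count_def by linarith
  show "rep_count m {0..<m} n \<le> m * m"
    using card_mono[OF _ sub] by (simp add: rep_count_def)
qed simp

end

(*
  In fact R_m <= 144 for every m, which is more than enough since R_m >= 0.

  For a prime p >= 11 and a suitable quadratic nonresidue g, let S be the union of the three
  parabolas y = c x^2 over F_p with c = 1, 2g/(1+g), g.  A point of F_p^2 is a sum of a point on
  y = c x^2 and a point on y = d x^2 in 0, 1 or 2 ways, depending on a discriminant.  The
  discriminants for the pairs (1, g) and (2g/(1+g), 2g/(1+g)) differ by g times a square, so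
  exactly one of them is a square unless both vanish.  Hence every point of F_p^2 is a sum of two
  elements of S in at least 1 and at most 16 ways.

  Write m = 2 h N + r with r < N, where p <= h <= 2p and 2p <= N <= 4p; by Bertrand's postulate
  such p, h, N exist for large m, with 2h and N both close to sqrt m.  Lift S periodically to Z^2,
  cut out a window of size about (p + N/2) x (p + h), and map it to Z_m by (x, y) -> x + N y.
  In each coordinate the window sums cover a full period, while the numbers of lifts of a residue,
  added over the translates by the period, total at most 3.  So every residue mod m is
  represented at least once and at most 16 * 3 * 3 = 144 times.  For small m the digits in base k,
  k^2 >= m, give a set with at most 2 k elements.
*)
theory Submission
  imports Defs "HOL-Number_Theory.Number_Theory" "HOL-Library.Discrete_Functions"
begin

section \<open>Bertrand's postulate\<close>

text \<open>Legendre's formula: passing from \<open>n\<close> to \<open>Suc n\<close> raises exactly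
  those quotients whose divisor \<open>p ^ i\<close> divides \<open>Suc n\<close>. The cutoff
  \<open>K\<close> is free so that the sums for \<open>n\<close> and \<open>2 * n\<close> can share
  one range.\<close>

lemma multiplicity_fact:
  fixes p n K :: nat
  assumes p: "prime p" and "n \<le> K"
  shows "multiplicity p (fact n) = (\<Sum>i=1..K. n div p ^ i)"
  using \<open>n \<le> K\<close>
proof (induction n)
  case 0
  then show ?case by simp
next
  case (Suc n)
  have "K < p ^ K"
    using prime_gt_1_nat[OF p] by (intro power_gt_expt) simp
  then have big: "\<not> p ^ i dvd Suc n" if "K < i" for i
    using that Suc.prems power_increasing[of K i p] prime_gt_0_nat[OF p]
    by (auto dest!: dvd_imp_le)
  have "{i\<in>{1..K}. p ^ i dvd Suc n} = {1..multiplicity p (Suc n)}"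
  proof (rule Set.set_eqI)
    fix i
    have "p ^ i dvd Suc n \<longleftrightarrow> i \<le> multiplicity p (Suc n)"
      by (rule power_dvd_iff_le_multiplicity) (use p in auto)
    then show "i \<in> {i\<in>{1..K}. p ^ i dvd Suc n} \<longleftrightarrow> i \<in> {1..multiplicity p (Suc n)}"
      using big[of i] by (auto simp: not_less[symmetric])
  qed
  then have "multiplicity p (Suc n) = card {i\<in>{1..K}. p ^ i dvd Suc n}"
    by simp
  also have "\<dots> = (\<Sum>i=1..K. if p ^ i dvd Suc n then 1 else 0)"
    by (simp add: sum.If_cases Int_def)
  finally have mult: "multiplicity p (Suc n) = (\<Sum>i=1..K. if p ^ i dvd Suc n then 1 else 0)" .
  have "multiplicity p (fact (Suc n)) = multiplicity p (Suc n) + multiplicity p (fact n)"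
    unfolding fact_Suc of_nat_id
    by (rule prime_elem_multiplicity_mult_distrib) (use p in auto)
  also have "\<dots> = (\<Sum>i=1..K. (if p ^ i dvd Suc n then 1 else 0) + n div p ^ i)"
    using Suc mult by (simp add: sum.distrib)
  also have "\<dots> = (\<Sum>i=1..K. Suc n div p ^ i)"
    by (intro sum.cong) (auto simp: div_Suc dvd_eq_mod_eq_0)
  finally show ?case .
qed

lemma multiplicity_central_binomial:
  fixes p n K :: nat
  assumes p: "prime p" and "2 * n \<le> K"
  shows "multiplicity p ((2 * n) choose n) = (\<Sum>i=1..K. (2 * n) div p ^ i - 2 * (n div p ^ i))"
proof -
  have "fact n * fact n * ((2 * n) choose n) = (fact (2 * n) :: nat)"
    using binomial_fact_lemma[of n "2 * n"] by simp
  then have "multiplicity p (fact (2 * n) :: nat)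
      = multiplicity p (fact n * fact n * ((2 * n) choose n))"
    by simp
  also have "\<dots> = multiplicity p (fact n :: nat) + multiplicity p (fact n :: nat) + multiplicity p ((2 * n) choose n)"
    using p by (simp add: prime_elem_multiplicity_mult_distrib)
  finally have "multiplicity p ((2 * n) choose n) = (\<Sum>i=1..K. (2 * n) div p ^ i) - (\<Sum>i=1..K. 2 * (n div p ^ i))"
    using multiplicity_fact[OF p, of n K] multiplicity_fact[OF p, of "2 * n" K] assms
    by (simp add: sum_distrib_left[symmetric])
  \<comment> \<open>Truncated subtraction can be done termwise because
    \<open>2 * (n div d) <= (2 * n) div d\<close>.\<close>
  also have "\<dots> = (\<Sum>i=1..K. (2 * n) div p ^ i - 2 * (n div p ^ i))"
    by (rule sum_subtractf_nat[symmetric]) (simp add: div_mult2_eq[symmetric] less_eq_div_iff_mult_less_eq[OF zero_less_power] prime_gt_0_nat[OF p])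
  finally show ?thesis .
qed

lemma div_double_le:
  fixes n d :: nat
  shows "(2 * n) div d - 2 * (n div d) \<le> (if d \<le> 2 * n then 1 else 0)"
proof (cases "d = 0")
  case False
  have "n < d * (n div d + 1)"
    using False by (simp add: dividend_less_times_div)
  then have "2 * n < (2 * (n div d) + 2) * d"
    by (simp add: algebra_simps)
  then have "(2 * n) div d < 2 * (n div d) + 2"
    by (rule less_mult_imp_div_less)
  then show ?thesis
    by auto
qed simp

text \<open>Each term of the formula for the multiplicity is at most 1 and vanishes once
  \<open>p ^ i > 2 * n\<close>, so the multiplicity is at most the largest \<open>i\<close> with
  \<open>p ^ i <= 2 * n\<close>.\<close>

lemma prime_power_central_binomial_le:
  fixes p n :: nat
  assumes p: "prime p" and "n > 0"
  shows "p ^ multiplicity p ((2 * n) choose n) \<le> 2 * n"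
proof -
  define I where "I = {i\<in>{1..2 * n}. p ^ i \<le> 2 * n}"
  have "multiplicity p ((2 * n) choose n) \<le> (\<Sum>i=1..2 * n. if p ^ i \<le> 2 * n then 1 else 0)"
    unfolding multiplicity_central_binomial[OF p order_refl] by (intro sum_mono div_double_le)
  also have "\<dots> = card I"
    by (simp add: sum.If_cases Int_def I_def)
  finally have le: "multiplicity p ((2 * n) choose n) \<le> card I" .
  have p1: "p \<ge> 1"
    using prime_ge_1_nat[OF p] .
  have "p ^ card I \<le> 2 * n"
  proof (cases "I = {}")
    case False
    have fin: "finite I" by (simp add: I_def)
    have "I \<subseteq> {1..Max I}"
      using fin by (auto simp: I_def)
    then have "card I \<le> Max I"
      using card_mono[of "{1..Max I}" I] by simp
    moreover have "p ^ Max I \<le> 2 * n"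
      using Max_in[OF fin False] by (simp add: I_def)
    ultimately show ?thesis
      using power_increasing[of "card I" "Max I" p] p1 by linarith
  qed (use \<open>n > 0\<close> in auto)
  then show ?thesis
    using power_increasing[OF le p1] by linarith
qed

text \<open>For a prime in (2n/3, n] the quotients for \<open>i = 1\<close> are 2 and 1, which
  cancel; \<open>p >= 3\<close> pushes \<open>p ^ 2\<close> above \<open>2 * n\<close>, so higher
  powers contribute nothing.\<close>

lemma multiplicity_central_binomial_eq_0:
  fixes p n :: nat
  assumes p: "prime p" and "p \<ge> 3" "p \<le> n" "2 * n < 3 * p"
  shows "multiplicity p ((2 * n) choose n) = 0"
proof -
  have "(2 * n) div p ^ i - 2 * (n div p ^ i) = 0" if "i \<ge> 1" for i
  proof (cases "i = 1")
    case True
    have "n div p = 1" "(2 * n) div p = 2"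
      using assms by (intro div_nat_eqI; simp)+
    then show ?thesis using True by simp
  next
    case False
    then have "p ^ 2 \<le> p ^ i"
      using that \<open>p \<ge> 3\<close> by (intro power_increasing) auto
    moreover have "3 * p \<le> p ^ 2"
      using \<open>p \<ge> 3\<close> by (simp add: power2_eq_square)
    ultimately have "2 * n < p ^ i"
      using assms by linarith
    then show ?thesis by simp
  qed
  then show ?thesis
    unfolding multiplicity_central_binomial[OF p order_refl] by simp
qed

section \<open>The primorial bound and the conclusion of Bertrand's postulate\<close>

lemma prod_primes_dvd:
  fixes m :: nat
  assumes "finite A" "\<And>p. p \<in> A \<Longrightarrow> prime p" "\<And>p. p \<in> A \<Longrightarrow> p dvd m"
  shows "\<Prod>A dvd m"
  using assms
proof (induction A)
  case (insert p A)
  have "coprime p (\<Prod>A)"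
    using insert by (intro prod_coprime_right) (metis insertCI primes_coprime)
  then show ?case
    using insert by (simp add: divides_mult)
qed simp

text \<open>Erdos's induction: an even \<open>n > 2\<close> adds no prime, and for
  \<open>n = 2 * k + 1\<close> the primes in (k + 1, n] all divide \<open>n choose k\<close>, which
  is at most \<open>4 ^ k\<close>.\<close>

lemma primorial_le: "\<Prod>{p. prime p \<and> p \<le> n} \<le> (4::nat) ^ n"
proof (induction n rule: less_induct)
  case (less n)
  have "n < 2 \<or> n = 2 \<or> (n > 2 \<and> even n) \<or> (\<exists>k. n = 2 * k + 1 \<and> k > 0)"
    by presburger
  then consider "n < 2" | "n = 2" | "n > 2" "even n" | k where "n = 2 * k + 1" "k > 0"
    by blast
  then show ?case
  proof cases
    case 1
    then have "{p. prime p \<and> p \<le> n} = {}"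
      by (auto dest: prime_ge_2_nat)
    then show ?thesis by (simp only: prod.empty) simp
  next
    case 2
    then have "{p. prime p \<and> p \<le> n} = {2}"
      by (auto dest: prime_ge_2_nat)
    then show ?thesis using 2 by simp
  next
    case 3
    have "{p. prime p \<and> p \<le> n} = {p. prime p \<and> p \<le> n - 1}"
    proof (intro Collect_cong conj_cong refl iffI)
      fix p assume "prime p" "p \<le> n"
      moreover have "\<not> prime n"
        using 3 prime_nat_not_dvd[of n 2] by auto
      ultimately show "p \<le> n - 1"
        by (cases "p = n") auto
    qed auto
    then have "\<Prod>{p. prime p \<and> p \<le> n} \<le> (4::nat) ^ (n - 1)"
      using less[of "n - 1"] 3 by simp
    also have "\<dots> \<le> 4 ^ n" by (intro power_increasing) auto
    finally show ?thesis .
  next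
    case 4
    let ?P = "{p. prime p \<and> p \<le> k + 1}" and ?Q = "{p. prime p \<and> k + 1 < p \<and> p \<le> n}"
    have fin: "finite ?P" "finite ?Q"
      by (rule finite_subset[of _ "{..n}"]; use 4 in force)+
    have "{p. prime p \<and> p \<le> n} = ?P \<union> ?Q"
      using 4 by auto
    then have split: "\<Prod>{p. prime p \<and> p \<le> n} = \<Prod>?P * \<Prod>?Q"
      using fin by (simp add: prod.union_disjoint[symmetric] disjoint_iff)
    have "\<Prod>?Q dvd (n choose k)"
    proof (rule prod_primes_dvd)
      fix p assume p: "p \<in> ?Q"
      have "fact k * fact (k + 1) * (n choose k) = (fact n :: nat)"
        using binomial_fact_lemma[of k n] 4 by simp
      moreover have "p dvd fact n" "\<not> p dvd fact k" "\<not> p dvd fact (k + 1)"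
        using p by (simp_all only: mem_Collect_eq prime_dvd_fact_iff) auto
      ultimately show "p dvd (n choose k)"
        using p by (metis mem_Collect_eq prime_dvd_mult_iff)
    qed (use fin in auto)
    then have "\<Prod>?Q \<le> (n choose k)"
      by (rule dvd_imp_le) (use 4 in auto)
    \<comment> \<open>The value \<open>n choose k\<close> occurs twice in row \<open>n\<close>,
      whose sum is \<open>2 ^ n\<close>.\<close>
    also have "2 * (n choose k) \<le> 2 ^ n"
    proof -
      have "(n choose k) + (n choose (k + 1)) = (\<Sum>i\<in>{k, k + 1}. n choose i)"
        by simp
      also have "\<dots> \<le> (\<Sum>i\<le>n. n choose i)"
        by (rule sum_mono2) (use 4 in auto)
      also have "n choose (k + 1) = n choose k"
        using binomial_symmetric[of k n] 4 by simp
      finally show ?thesis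
        by (simp add: choose_row_sum)
    qed
    then have "n choose k \<le> 4 ^ k"
      using 4 by (simp add: power_mult)
    finally have "\<Prod>?P * \<Prod>?Q \<le> 4 ^ (k + 1) * 4 ^ k"
      using less[of "k + 1"] 4 by (intro mult_mono) auto
    then show ?thesis
      using 4 split by (simp add: power_add mult_2)
  qed
qed

text \<open>The sixth power arises in \<open>bertrand_large\<close> from cubing
  \<open>2 * n < (s + 1) ^ 2\<close>. The induction step rests on 1.1^6 < 2.\<close>

lemma power6_less_power2:
  fixes s :: nat
  assumes "s \<ge> 32"
  shows "(s + 1) ^ 6 < 2 ^ (s - 1)"
  using assms
proof (induction s rule: dec_induct)
  case (step s)
  have "10 * (s + 2) \<le> 11 * (s + 1)"
    using step by simp
  then have "(10 * (s + 2)) ^ 6 \<le> (11 * (s + 1)) ^ 6"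
    by (rule power_mono) simp
  then have "10 ^ 6 * (s + 2) ^ 6 \<le> 11 ^ 6 * (s + 1) ^ 6"
    by (simp only: power_mult_distrib)
  then have "(s + 2) ^ 6 \<le> 2 * (s + 1) ^ 6"
    by simp
  also have "\<dots> < 2 * 2 ^ (s - 1)"
    using step by simp
  also have "\<dots> = 2 ^ s"
    using step by (simp add: power_Suc[symmetric] del: power_Suc)
  finally show ?case by simp
qed simp

text \<open>Primes up to \<open>s\<close> contribute at most \<open>2n\<close> each; the larger ones divide the binomial at most
  once, and do not exceed \<open>2n/3\<close> if there are none in \<open>(n, 2n]\<close>.\<close>

lemma central_binomial_le:
  fixes n s :: nat
  assumes "n \<ge> 5" and s: "2 * n < (s + 1) ^ 2" and no: "\<And>p. prime p \<Longrightarrow> n < p \<Longrightarrow> p \<le> 2 * n \<Longrightarrow> False"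
  shows "(2 * n) choose n \<le> (2 * n) ^ s * 4 ^ ((2 * n) div 3)"
proof -
  let ?N = "(2 * n) choose n"
  let ?A = "{p\<in>prime_factors ?N. p \<le> s}" and ?B = "{p\<in>prime_factors ?N. s < p}"
  let ?R = "{p. prime p \<and> p \<le> (2 * n) div 3}"
  have "?N = (\<Prod>p\<in>prime_factors ?N. p ^ multiplicity p ?N)"
    by (rule prime_factorization_nat) simp
  also have "prime_factors ?N = ?A \<union> ?B"
    by auto
  also have "(\<Prod>p\<in>?A \<union> ?B. p ^ multiplicity p ?N) = (\<Prod>p\<in>?A. p ^ multiplicity p ?N) * (\<Prod>p\<in>?B. p ^ multiplicity p ?N)"
    by (rule prod.union_disjoint) auto
  also have "(\<Prod>p\<in>?A. p ^ multiplicity p ?N) \<le> (\<Prod>p\<in>?A. 2 * n)"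
    using \<open>n \<ge> 5\<close> by (intro prod_mono conjI prime_power_central_binomial_le) auto
  also have "\<dots> = (2 * n) ^ card ?A"
    by simp
  also have "\<dots> \<le> (2 * n) ^ s"
  proof (rule power_increasing)
    have "?A \<subseteq> {1..s}"
      by (auto dest!: in_prime_factors_imp_prime prime_gt_0_nat)
    then show "card ?A \<le> s"
      using card_mono[of "{1..s}" ?A] by simp
  qed (use \<open>n \<ge> 5\<close> in auto)
  also have "(\<Prod>p\<in>?B. p ^ multiplicity p ?N) \<le> (\<Prod>p\<in>?B. p)"
  proof (rule prod_mono, intro conjI)
    fix p assume p: "p \<in> ?B"
    then have "prime p" by auto
    have "(s + 1) ^ 2 \<le> p ^ 2"
      using p by (intro power_mono) auto
    then have "p ^ 2 > 2 * n"
      using s by linarith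
    then have "p ^ multiplicity p ?N < p ^ 2"
      using prime_power_central_binomial_le[OF \<open>prime p\<close>, of n] \<open>n \<ge> 5\<close> by linarith
    then have "multiplicity p ?N < 2"
      using prime_gt_1_nat[OF \<open>prime p\<close>] by (rule_tac power_less_imp_less_exp)
    then show "p ^ multiplicity p ?N \<le> p"
      using prime_ge_1_nat[OF \<open>prime p\<close>] power_increasing[of "multiplicity p ?N" 1 p] by simp
  qed simp
  also have "(\<Prod>p\<in>?B. p) \<le> \<Prod>?R"
  proof (rule dvd_imp_le, rule prod_dvd_prod_subset)
    show fin: "finite ?R"
      by (rule finite_subset[of _ "{..(2 * n) div 3}"]) auto
    show "0 < \<Prod>?R"
      by (rule prod_pos) (auto intro: prime_gt_0_nat)
    show "?B \<subseteq> ?R"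
    proof
      fix p assume p: "p \<in> ?B"
      then have "prime p" and pd: "p dvd ?N" by (auto simp: prime_factors_dvd)
      have "?N dvd fact (2 * n)"
        using binomial_fact_lemma[of n "2 * n"] by (metis dvd_triv_right le_add2 mult_2)
      then have "p dvd fact (2 * n)"
        using pd dvd_trans by blast
      then have "p \<le> n"
        using no[OF \<open>prime p\<close>] prime_dvd_fact_iff[OF \<open>prime p\<close>] by force
      have "multiplicity p ?N > 0"
        using p by (simp add: prime_factors_multiplicity)
      \<comment> \<open>The prime 2 is outside the scope of
        \<open>multiplicity_central_binomial_eq_0\<close>; for it \<open>n >= 5\<close> gives the
        bound directly.\<close>
      then have "p \<le> 2 \<or> 3 * p \<le> 2 * n"
        using multiplicity_central_binomial_eq_0[OF \<open>prime p\<close> _ \<open>p \<le> n\<close>] by force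
      then have "3 * p \<le> 2 * n"
        using \<open>n \<ge> 5\<close> by auto
      then show "p \<in> ?R"
        using \<open>prime p\<close> by auto
    qed
  qed
  also have "\<Prod>?R \<le> 4 ^ ((2 * n) div 3)"
    by (rule primorial_le)
  finally show ?thesis
    by (simp add: mult_mono)
qed

text \<open>The central binomial coefficient is at least 4^n / (2n), but without a prime in (n, 2n]
  it would be at most \<open>(2 * n) ^ s * 4 ^ ((2 * n) div 3)\<close>, which is too small. The
  threshold 512 is what makes \<open>s >= 32\<close>.\<close>

lemma bertrand_large:
  fixes n :: nat
  assumes "n \<ge> 512"
  shows "\<exists>p. prime p \<and> n < p \<and> p \<le> 2 * n"
proof (rule ccontr)
  assume no: "\<not> ?thesis"
  define s where "s = floor_sqrt (2 * n)"
  have s1: "s ^ 2 \<le> 2 * n" and s2: "2 * n < (s + 1) ^ 2"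
    unfolding s_def using floor_sqrt_power2_le Suc_floor_sqrt_power2_gt by auto
  have "s \<ge> 32"
    unfolding s_def using \<open>n \<ge> 512\<close> by (intro le_floor_sqrtI) auto
  have "4 ^ n \<le> 2 * n * ((2 * n) choose n)"
  proof -
    have "4 ^ n / (2 * real n) \<le> real ((2 * n) choose n)"
      by (rule central_binomial_lower_bound) (use assms in simp)
    then have "real (4 ^ n) \<le> real (2 * n * ((2 * n) choose n))"
      using assms by (simp add: field_simps)
    then show ?thesis
      by (simp only: of_nat_le_iff)
  qed
  also have "\<dots> \<le> 2 * n * ((2 * n) ^ s * 4 ^ ((2 * n) div 3))"
    using central_binomial_le[OF _ s2] no assms by (intro mult_left_mono) auto
  also have "\<dots> = (2 * n) ^ (s + 1) * 4 ^ ((2 * n) div 3)"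
    by simp
  \<comment> \<open>Cubing clears the division by 3; it remains to see that
    \<open>((2 * n) ^ 3) ^ (s + 1)\<close> is below \<open>4 ^ n\<close>.\<close>
  finally have "(4 ^ n) ^ 3 \<le> ((2 * n) ^ (s + 1) * 4 ^ ((2 * n) div 3)) ^ 3"
    by (rule power_mono) simp
  also have "\<dots> = ((2 * n) ^ 3) ^ (s + 1) * 4 ^ (3 * ((2 * n) div 3))"
    by (simp only: power_mult_distrib power_mult[symmetric] mult.commute)
  also have "\<dots> \<le> (((s + 1) ^ 2) ^ 3) ^ (s + 1) * 4 ^ (2 * n)"
  proof (rule mult_mono)
    show "((2 * n) ^ 3) ^ (s + 1) \<le> (((s + 1) ^ 2) ^ 3) ^ (s + 1)"
      by (rule power_mono[OF power_mono[OF less_imp_le[OF s2]]]) simp_all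
    show "4 ^ (3 * ((2 * n) div 3)) \<le> (4::nat) ^ (2 * n)"
      by (rule power_increasing) simp_all
  qed simp_all
  also have "((s + 1) ^ 2) ^ 3 = (s + 1) ^ 6"
    by (simp flip: power_mult)
  also have "((s + 1) ^ 6) ^ (s + 1) \<le> (2 ^ (s - 1)) ^ (s + 1)"
    using power6_less_power2[OF \<open>s \<ge> 32\<close>] by (intro power_mono) auto
  also have "(2 ^ (s - 1)) ^ (s + 1) = (2::nat) ^ (s ^ 2 - 1)"
  proof -
    have "(s - 1) * (s + 1) = s ^ 2 - 1"
      by (simp add: power2_eq_square algebra_simps diff_mult_distrib)
    then show ?thesis
      by (simp only: power_mult[symmetric])
  qed
  also have "\<dots> < 4 ^ n"
  proof -
    have "s ^ 2 - 1 < 2 * n" using s1 \<open>n \<ge> 512\<close> by linarith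
    then have "(2::nat) ^ (s ^ 2 - 1) < 2 ^ (2 * n)" by (rule power_strict_increasing) simp
    then show ?thesis by (simp add: power_mult)
  qed
  also have "4 ^ n * 4 ^ (2 * n) = ((4::nat) ^ n) ^ 3"
    by (simp add: power_add[symmetric] power_mult[symmetric])
  finally show False
    by simp
qed

text \<open>The candidate divisors form a list so that concrete instances are decided by
  simplification.\<close>

lemma prime_by_trial_division:
  fixes p k :: nat
  assumes "1 < p" "p < k * k" and "\<forall>d\<in>set [2..<k]. \<not> d dvd p"
  shows "prime p"
proof (rule ccontr)
  assume "\<not> prime p"
  then obtain a b where ab: "p = a * b" "1 < a" "1 < b"
    using \<open>1 < p\<close> prime_nat_iff by (metis One_nat_def dvd_def less_one linorder_neqE_nat mult.right_neutral mult_0_right nat_dvd_1_iff_1 not_less_zero mult_is_0)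
  have "a < k \<or> b < k"
    using \<open>p < k * k\<close> mult_le_mono[of k a k b] ab(1) by linarith
  moreover have "a \<notin> {2..<k}" "b \<notin> {2..<k}"
    using assms(3) ab(1) by (metis dvd_triv_left dvd_triv_right set_upt)+
  ultimately show False
    using ab by auto
qed

theorem bertrand:
  fixes n :: nat
  assumes "n \<ge> 12"
  shows "\<exists>p. prime p \<and> n < p \<and> p \<le> 2 * n"
proof -
  \<comment> \<open>Each of these primes is less than twice its predecessor, the first is below 2 *
    12, and the last exceeds 512.\<close>
  have primes: "prime (23::nat)" "prime (43::nat)" "prime (83::nat)"
      "prime (163::nat)" "prime (317::nat)" "prime (631::nat)"
    by (rule prime_by_trial_division[of _ 5] prime_by_trial_division[of _ 7]
        prime_by_trial_division[of _ 10] prime_by_trial_division[of _ 13]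
        prime_by_trial_division[of _ 18] prime_by_trial_division[of _ 26]; simp; fail)+
  consider "n < 23" | "23 \<le> n" "n < 43" | "43 \<le> n" "n < 83" | "83 \<le> n" "n < 163"
    | "163 \<le> n" "n < 317" | "317 \<le> n" "n < 631" | "n \<ge> 512"
    by linarith
  then show ?thesis
  proof cases
    case 1 then show ?thesis using assms by (intro exI[of _ 23] conjI primes) linarith+
  next
    case 2 then show ?thesis using assms by (intro exI[of _ 43] conjI primes) linarith+
  next
    case 3 then show ?thesis using assms by (intro exI[of _ 83] conjI primes) linarith+
  next
    case 4 then show ?thesis using assms by (intro exI[of _ 163] conjI primes) linarith+
  next
    case 5 then show ?thesis using assms by (intro exI[of _ 317] conjI primes) linarith+
  next
    case 6 then show ?thesis using assms by (intro exI[of _ 631] conjI primes) linarith+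
  next
    case 7 then show ?thesis by (rule bertrand_large)
  qed
qed

section \<open>Sums of points on parabolas modulo a prime\<close>

lemma finite_bounded_Collect_int [simp]: "finite {x::int. a \<le> x \<and> x < b \<and> Q x}"
  by (rule finite_subset[of _ "{a..<b}"]) auto

lemma card_linear_roots_le_1:
  fixes P a b :: int
  assumes "prime P" "\<not> P dvd a"
  shows "card {x\<in>{0..<P}. P dvd a * x - b} \<le> 1"
proof -
  have "x = y" if "x \<in> {0..<P}" "y \<in> {0..<P}" "P dvd a * x - b" "P dvd a * y - b" for x y
  proof -
    have "P dvd (a * x - b) - (a * y - b)"
      using that(3,4) by (rule dvd_diff)
    also have "(a * x - b) - (a * y - b) = a * (x - y)"
      by (simp add: algebra_simps)
    finally have "P dvd x - y"
      using assms by (simp add: prime_dvd_mult_iff)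
    then show ?thesis
      using that cong_less_imp_eq_int[of x P y] by (simp add: cong_iff_dvd_diff)
  qed
  then show ?thesis
    unfolding One_nat_def by (subst card_le_Suc0_iff_eq) auto
qed

text \<open>Euler's criterion makes the Legendre symbol multiplicative modulo \<open>p\<close>, and
  \<open>p > 2\<close> keeps 1 and -1 distinct there.\<close>

lemma QuadRes_mult_nonresidue:
  fixes p :: nat and a b :: int
  assumes "prime p" "2 < p" "\<not> QuadRes (int p) a" "\<not> int p dvd b"
  shows "QuadRes (int p) (a * b) \<longleftrightarrow> \<not> QuadRes (int p) b"
proof -
  have "[0\<^sup>2 = a] (mod int p)" if "[a = 0] (mod int p)"
    using that cong_sym by simp
  then have a: "\<not> [a = 0] (mod int p)"
    using assms(3) unfolding QuadRes_def by blast
  have b: "\<not> [b = 0] (mod int p)"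
    using assms by (simp add: cong_0_iff)
  have ab: "\<not> [a * b = 0] (mod int p)"
    using a b assms(1) by (simp add: cong_0_iff prime_dvd_mult_iff)
  have "[Legendre a p * Legendre b p = a ^ ((p - 1) div 2) * b ^ ((p - 1) div 2)] (mod int p)"
    by (intro cong_mult euler_criterion assms)
  then have "[Legendre (a * b) p = Legendre a p * Legendre b p] (mod int p)"
    using euler_criterion[OF assms(1,2), of "a * b"]
    by (simp add: power_mult_distrib) (metis cong_sym cong_trans)
  moreover have "\<not> [1 = - 1] (mod int p)" "\<not> [-1 = 1] (mod int p)"
    using zdvd_not_zless[of 2 "int p"] \<open>2 < p\<close> by (auto simp: cong_iff_dvd_diff)
  ultimately show ?thesis
    using a b ab assms(3) by (auto simp: Legendre_def split: if_splits)
qed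

lemma QuadRes_mult_square:
  fixes P k a :: int
  assumes "prime P" "\<not> P dvd k"
  shows "QuadRes P (k\<^sup>2 * a) \<longleftrightarrow> QuadRes P a"
proof
  assume "QuadRes P a"
  then obtain y where "[y\<^sup>2 = a] (mod P)"
    unfolding QuadRes_def by blast
  then have "[(k * y)\<^sup>2 = k\<^sup>2 * a] (mod P)"
    by (simp add: power_mult_distrib cong_scalar_left)
  then show "QuadRes P (k\<^sup>2 * a)"
    unfolding QuadRes_def by blast
next
  assume "QuadRes P (k\<^sup>2 * a)"
  then obtain y where y: "[y\<^sup>2 = k\<^sup>2 * a] (mod P)"
    unfolding QuadRes_def by blast
  have "coprime k P"
    using assms prime_imp_coprime[of P k] by (simp add: coprime_commute)
  then obtain l where l: "[k * l = 1] (mod P)"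
    using cong_solve_coprime_int by blast
  have "[(l * y)\<^sup>2 = l\<^sup>2 * (k\<^sup>2 * a)] (mod P)"
    using y by (simp add: power_mult_distrib cong_scalar_left)
  also have "l\<^sup>2 * (k\<^sup>2 * a) = (k * l)\<^sup>2 * a"
    by (simp add: power_mult_distrib)
  also have "[\<dots> = 1\<^sup>2 * a] (mod P)"
    by (intro cong_mult cong_pow l) simp
  finally show "QuadRes P a"
    unfolding QuadRes_def by auto
qed

text \<open>Parametrizes the ways to write \<open>(X, Y)\<close> as a sum of a point on \<open>y = c x\<^sup>2\<close> and a point on \<open>y = d x\<^sup>2\<close>.\<close>

definition conic_roots :: "int \<Rightarrow> int \<Rightarrow> int \<Rightarrow> int \<Rightarrow> int \<Rightarrow> int set" where
  "conic_roots P c d X Y = {x\<in>{0..<P}. P dvd c * x\<^sup>2 + d * (X - x)\<^sup>2 - Y}"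

text \<open>A quarter of the discriminant of \<open>c * x\<^sup>2 + d * (X - x)\<^sup>2 - Y\<close>
  as a quadratic in \<open>x\<close>.\<close>

definition conic_disc :: "int \<Rightarrow> int \<Rightarrow> int \<Rightarrow> int \<Rightarrow> int" where
  "conic_disc c d X Y = (c + d) * Y - c * d * X\<^sup>2"

lemma finite_conic_roots [simp]: "finite (conic_roots P c d X Y)"
  by (simp add: conic_roots_def)

text \<open>Completing the square after multiplication by \<open>c + d\<close>, a unit modulo
  \<open>P\<close>.\<close>

lemma conic_roots_altdef:
  assumes "prime P" "\<not> P dvd c + d"
  shows "conic_roots P c d X Y = {x\<in>{0..<P}. P dvd ((c + d) * x - d * X)\<^sup>2 - conic_disc c d X Y}"
proof -
  have "((c + d) * x - d * X)\<^sup>2 - conic_disc c d X Y = (c + d) * (c * x\<^sup>2 + d * (X - x)\<^sup>2 - Y)" for x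
    by (simp add: conic_disc_def power2_eq_square algebra_simps)
  then show ?thesis
    using assms by (simp add: conic_roots_def prime_dvd_mult_iff)
qed

text \<open>Factoring the difference of two completed squares shows that every root other than a
  fixed \<open>x0\<close> solves the linear congruence of the conjugate root.\<close>

lemma card_conic_roots_le_2:
  assumes "prime P" "\<not> P dvd c + d"
  shows "card (conic_roots P c d X Y) \<le> 2"
proof (cases "conic_roots P c d X Y = {}")
  case False
  then obtain x0 where x0: "x0 \<in> conic_roots P c d X Y"
    by blast
  let ?L = "{x\<in>{0..<P}. P dvd (c + d) * x - (2 * d * X - (c + d) * x0)}"
  have "conic_roots P c d X Y \<subseteq> insert x0 ?L"
  proof
    fix x assume x: "x \<in> conic_roots P c d X Y"
    let ?z = "\<lambda>x. (c + d) * x - d * X"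
    have "P dvd (?z x)\<^sup>2 - conic_disc c d X Y" "P dvd (?z x0)\<^sup>2 - conic_disc c d X Y"
      using x x0 by (auto simp: conic_roots_altdef[OF assms])
    from dvd_diff[OF this] have "P dvd (?z x)\<^sup>2 - (?z x0)\<^sup>2"
      by simp
    also have "(?z x)\<^sup>2 - (?z x0)\<^sup>2 = (c + d) * (x - x0) * ((c + d) * x - (2 * d * X - (c + d) * x0))"
      by (simp add: power2_eq_square algebra_simps)
    finally have "P dvd x - x0 \<or> P dvd (c + d) * x - (2 * d * X - (c + d) * x0)"
      using assms by (simp add: prime_dvd_mult_iff)
    moreover have "x = x0" if "P dvd x - x0"
      using that x x0 cong_less_imp_eq_int[of x P x0] by (simp add: cong_iff_dvd_diff conic_roots_def)
    ultimately show "x \<in> insert x0 ?L"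
      using x by (auto simp: conic_roots_def)
  qed
  then have "card (conic_roots P c d X Y) \<le> card (insert x0 ?L)"
    by (intro card_mono) auto
  also have "\<dots> \<le> Suc (card ?L)"
    by (rule card_insert_le_m1) simp_all
  also have "card ?L \<le> 1"
    by (rule card_linear_roots_le_1) (use assms in auto)
  finally show ?thesis by simp
qed simp

lemma card_conic_roots_le_1:
  assumes "prime P" "\<not> P dvd c + d" "P dvd conic_disc c d X Y"
  shows "card (conic_roots P c d X Y) \<le> 1"
proof -
  have "conic_roots P c d X Y \<subseteq> {x\<in>{0..<P}. P dvd (c + d) * x - d * X}"
  proof
    fix x assume x: "x \<in> conic_roots P c d X Y"
    then have "P dvd (((c + d) * x - d * X)\<^sup>2 - conic_disc c d X Y) + conic_disc c d X Y"
      using assms by (intro dvd_add) (auto simp: conic_roots_altdef)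
    then show "x \<in> {x\<in>{0..<P}. P dvd (c + d) * x - d * X}"
      using x \<open>prime P\<close> by (simp add: conic_roots_def prime_dvd_power_iff)
  qed
  then have "card (conic_roots P c d X Y) \<le> card {x\<in>{0..<P}. P dvd (c + d) * x - d * X}"
    by (intro card_mono) auto
  also have "\<dots> \<le> 1"
    by (rule card_linear_roots_le_1) (use assms in auto)
  finally show ?thesis .
qed

lemma conic_roots_eq_empty_iff:
  assumes "prime P" "\<not> P dvd c + d"
  shows "conic_roots P c d X Y = {} \<longleftrightarrow> \<not> QuadRes P (conic_disc c d X Y)"
proof
  assume "\<not> QuadRes P (conic_disc c d X Y)"
  then show "conic_roots P c d X Y = {}"
    by (auto simp: conic_roots_altdef[OF assms] QuadRes_def cong_iff_dvd_diff)
next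
  assume empty: "conic_roots P c d X Y = {}"
  show "\<not> QuadRes P (conic_disc c d X Y)"
  proof
    assume "QuadRes P (conic_disc c d X Y)"
    then obtain z where z: "[z\<^sup>2 = conic_disc c d X Y] (mod P)"
      unfolding QuadRes_def by blast
    have "coprime (c + d) P"
      using assms prime_imp_coprime[of P "c + d"] by (simp add: coprime_commute)
    then obtain l where l: "[(c + d) * l = 1] (mod P)"
      using cong_solve_coprime_int by blast
    define x where "x = (l * (z + d * X)) mod P"
    have "[(c + d) * x = (c + d) * (l * (z + d * X))] (mod P)"
      unfolding x_def by (intro cong_mult) simp_all
    also have "(c + d) * (l * (z + d * X)) = (c + d) * l * (z + d * X)"
      by simp
    also have "[\<dots> = 1 * (z + d * X)] (mod P)"
      by (intro cong_mult l) simp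
    finally have "[(c + d) * x - d * X = 1 * (z + d * X) - d * X] (mod P)"
      by (intro cong_diff) simp_all
    then have "[((c + d) * x - d * X)\<^sup>2 = z\<^sup>2] (mod P)"
      by (intro cong_pow) simp
    then have "[((c + d) * x - d * X)\<^sup>2 = conic_disc c d X Y] (mod P)"
      using z cong_trans by blast
    moreover have "x \<in> {0..<P}"
      using prime_gt_0_int[OF \<open>prime P\<close>] by (simp add: x_def)
    ultimately have "x \<in> conic_roots P c d X Y"
      by (simp add: conic_roots_altdef[OF assms] cong_iff_dvd_diff)
    then show False
      using empty by simp
  qed
qed

section \<open>Choice of the three parabolas\<close>

lemma exists_generic_nonresidue:
  fixes p :: nat
  assumes "prime p" "11 \<le> p"
  obtains g where "\<not> QuadRes (int p) g" "\<not> int p dvd g + 1" "\<not> int p dvd g + 3" "\<not> int p dvd 3 * g + 1"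
proof -
  let ?P = "int p"
  define Sq where "Sq = (\<lambda>y. y\<^sup>2 mod ?P) ` {0..(?P - 1) div 2}"
  \<comment> \<open>The values of \<open>g\<close> excluded below are those for which a sum of two
    coefficients in \<open>exists_three_conics\<close> would vanish modulo \<open>p\<close>.\<close>
  define bad where "bad a b = {x\<in>{0..<?P}. ?P dvd a * x - b}" for a b
  have P: "prime ?P" using assms by simp
  have ndvd: "\<not> ?P dvd 1" "\<not> ?P dvd 3"
    using zdvd_not_zless[of 3 ?P] zdvd_not_zless[of 1 ?P] assms by auto
  have odd: "odd p"
    using assms prime_odd_nat by auto
  have bads: "card (bad 1 (-1)) \<le> 1" "card (bad 1 (-3)) \<le> 1" "card (bad 3 (-1)) \<le> 1"
    unfolding bad_def by (intro card_linear_roots_le_1 P ndvd)+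
  have "card Sq \<le> card {0..(?P - 1) div 2}"
    unfolding Sq_def by (rule card_image_le) simp
  also have "2 * \<dots> = p + 1"
    using odd by (auto elim!: oddE)
  finally have Sq: "2 * card Sq \<le> p + 1" by simp
  \<comment> \<open>At most (p + 1)/2 squares and three excluded values, fewer than \<open>p\<close>
    in all since \<open>p >= 11\<close>.\<close>
  let ?U = "Sq \<union> (bad 1 (-1) \<union> (bad 1 (-3) \<union> bad 3 (-1)))"
  have "card ?U \<le> card Sq + (card (bad 1 (-1)) + (card (bad 1 (-3)) + card (bad 3 (-1))))"
    by (meson card_Un_le add_left_mono order_trans)
  then have "card ?U < card {0..<?P}"
    using bads Sq assms by simp
  moreover have "finite ?U"
    by (auto simp: Sq_def bad_def)
  ultimately have "\<not> {0..<?P} \<subseteq> ?U"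
    by (meson card_mono leD)
  then obtain g where g: "g \<in> {0..<?P}" "g \<notin> ?U"
    by blast
  have "\<not> QuadRes ?P g"
  proof
    assume "QuadRes ?P g"
    then obtain y where y: "[y\<^sup>2 = g] (mod ?P)"
      unfolding QuadRes_def by blast
    \<comment> \<open>The representative of \<open>y\<close> or \<open>-y\<close> in the lower half
      of the residues; both have the same square.\<close>
    define z where "z = (if y mod ?P \<le> (?P - 1) div 2 then y mod ?P else ?P - y mod ?P)"
    have "z \<in> {0..(?P - 1) div 2}"
      using odd pos_mod_bound[of ?P y] pos_mod_sign[of ?P y] assms
      by (auto simp: z_def simp del: pos_mod_bound elim!: oddE)
    moreover have "z\<^sup>2 mod ?P = g"
    proof -
      have "[z\<^sup>2 = (y mod ?P)\<^sup>2] (mod ?P)"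
        by (auto simp: z_def cong_iff_dvd_diff power2_eq_square algebra_simps)
      also have "[(y mod ?P)\<^sup>2 = y\<^sup>2] (mod ?P)"
        by (intro cong_pow) simp
      also note y
      finally show ?thesis
        using g by (simp add: cong_def)
    qed
    ultimately have "g \<in> Sq"
      unfolding Sq_def by blast
    then show False using g by blast
  qed
  moreover have "\<not> ?P dvd g + 1" "\<not> ?P dvd g + 3" "\<not> ?P dvd 3 * g + 1"
    using g by (auto simp: bad_def)
  ultimately show ?thesis
    using that by blast
qed

lemma card_less_3_square_sum:
  fixes f :: "nat \<Rightarrow> nat \<Rightarrow> nat"
  shows "(\<Sum>i<3. \<Sum>j<3. f i j)
    = f 0 0 + f 0 1 + f 0 2 + f 1 0 + f 1 1 + f 1 2 + f 2 0 + f 2 1 + f 2 2"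
  by (simp add: numeral_3_eq_3 numeral_2_eq_2)

text \<open>Put D = Y - g X^2. Up to nonzero square factors, the pairs (0,2) and (2,0) have
  discriminant D and the pair (1,1) has g D. These three pairs always supply a root and never more
  than 4; the other six pairs supply at most 2 each, and 4 + 12 = 16.\<close>

lemma exists_three_conics:
  fixes p :: nat
  assumes "prime p" "11 \<le> p"
  obtains c :: "nat \<Rightarrow> int" where
    "\<And>X Y. \<exists>i<3. \<exists>j<3. conic_roots (int p) (c i) (c j) X Y \<noteq> {}"
    "\<And>X Y. (\<Sum>i<3. \<Sum>j<3. card (conic_roots (int p) (c i) (c j) X Y)) \<le> 16"
proof -
  let ?P = "int p"
  obtain g where g: "\<not> QuadRes ?P g" "\<not> ?P dvd g + 1" "\<not> ?P dvd g + 3" "\<not> ?P dvd 3 * g + 1"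
    using exists_generic_nonresidue assms by blast
  have P: "prime ?P" using assms by simp
  have ndvd: "\<not> ?P dvd 2" "\<not> ?P dvd g"
  proof -
    show "\<not> ?P dvd 2"
      using zdvd_not_zless[of 2 ?P] assms by auto
    have "?P dvd g \<Longrightarrow> [0\<^sup>2 = g] (mod ?P)"
      by (simp add: cong_iff_dvd_diff)
    then show "\<not> ?P dvd g"
      using g(1) unfolding QuadRes_def by blast
  qed
  \<comment> \<open>The coefficients \<open>1\<close>, \<open>2g/(1+g)\<close>, \<open>g\<close>, multiplied by \<open>1+g\<close> to avoid inverses.\<close>
  define c where "c i = (if i = 0 then g + 1 else if i = 1 then 2 * g else g * (g + 1))" for i :: nat
  have c: "c 0 = g + 1" "c 1 = 2 * g" "c 2 = g * (g + 1)"
    by (simp_all add: c_def)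
  have sums: "c 0 + c 0 = 2 * (g + 1)" "c 0 + c 1 = 3 * g + 1" "c 1 + c 0 = 3 * g + 1"
    "c 0 + c 2 = (g + 1) * (g + 1)" "c 2 + c 0 = (g + 1) * (g + 1)" "c 1 + c 1 = 2 * 2 * g"
    "c 1 + c 2 = g * (g + 3)" "c 2 + c 1 = g * (g + 3)" "c 2 + c 2 = 2 * g * (g + 1)"
    unfolding c by (simp_all add: algebra_simps)
  have nz: "\<not> ?P dvd c i + c j" if "i < 3" "j < 3" for i j
  proof -
    have "i = 0 \<or> i = 1 \<or> i = 2" "j = 0 \<or> j = 1 \<or> j = 2"
      using that by auto
    then show ?thesis
      using g ndvd P by (elim disjE; simp only: sums prime_dvd_mult_iff; simp)
  qed
  let ?R = "\<lambda>i j X Y. conic_roots ?P (c i) (c j) X Y"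
  have le2: "card (?R i j X Y) \<le> 2" if "i < 3" "j < 3" for i j X Y
    using card_conic_roots_le_2[OF P nz[OF that]] .
  have disc: "conic_disc (c 0) (c 2) X Y = (g + 1)\<^sup>2 * (Y - g * X\<^sup>2)"
    "conic_disc (c 2) (c 0) X Y = (g + 1)\<^sup>2 * (Y - g * X\<^sup>2)"
    "conic_disc (c 1) (c 1) X Y = 2\<^sup>2 * (g * (Y - g * X\<^sup>2))" for X Y
    unfolding conic_disc_def c by (simp_all add: power2_eq_square algebra_simps)
  have QR: "QuadRes ?P (conic_disc (c 0) (c 2) X Y) \<longleftrightarrow> QuadRes ?P (Y - g * X\<^sup>2)"
    "QuadRes ?P (conic_disc (c 2) (c 0) X Y) \<longleftrightarrow> QuadRes ?P (Y - g * X\<^sup>2)"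
    "QuadRes ?P (conic_disc (c 1) (c 1) X Y) \<longleftrightarrow> QuadRes ?P (g * (Y - g * X\<^sup>2))" for X Y
    unfolding disc using g(2) ndvd(1) P QuadRes_mult_square by blast+
  have empty_iff: "?R i j X Y = {} \<longleftrightarrow> \<not> QuadRes ?P (conic_disc (c i) (c j) X Y)"
    if "i < 3" "j < 3" for i j X Y
    using conic_roots_eq_empty_iff[OF P nz[OF that]] .
  \<comment> \<open>If D vanishes modulo \<open>p\<close>, all three discriminants vanish and each
    pair has at most one root, with 0 being a square; otherwise exactly one of D and g D is a
    square.\<close>
  have key: "(?R 0 2 X Y \<noteq> {} \<or> ?R 1 1 X Y \<noteq> {})
      \<and> card (?R 0 2 X Y) + card (?R 2 0 X Y) + card (?R 1 1 X Y) \<le> 4" for X Y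
  proof (cases "?P dvd Y - g * X\<^sup>2")
    case True
    then have "?P dvd conic_disc (c 0) (c 2) X Y" "?P dvd conic_disc (c 2) (c 0) X Y"
      "?P dvd conic_disc (c 1) (c 1) X Y"
      unfolding disc by simp_all
    then have "card (?R 0 2 X Y) \<le> 1" "card (?R 2 0 X Y) \<le> 1" "card (?R 1 1 X Y) \<le> 1"
      by (intro card_conic_roots_le_1 P nz; simp)+
    moreover have "QuadRes ?P (Y - g * X\<^sup>2)"
      unfolding QuadRes_def using True
      by (intro exI[of _ 0]) (metis cong_0_iff cong_sym zero_power2)
    ultimately show ?thesis
      by (simp add: empty_iff QR del: One_nat_def)
  next
    case False
    then have "QuadRes ?P (g * (Y - g * X\<^sup>2)) \<longleftrightarrow> \<not> QuadRes ?P (Y - g * X\<^sup>2)"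
      using assms g by (intro QuadRes_mult_nonresidue) auto
    then consider "?R 0 2 X Y \<noteq> {}" "?R 1 1 X Y = {}" | "?R 0 2 X Y = {}" "?R 2 0 X Y = {}" "?R 1 1 X Y \<noteq> {}"
      by (auto simp: empty_iff QR simp del: One_nat_def)
    then show ?thesis
      using le2[of 0 2 X Y] le2[of 2 0 X Y] le2[of 1 1 X Y] by cases auto
  qed
  show ?thesis
  proof (rule that)
    show "\<exists>i<3. \<exists>j<3. ?R i j X Y \<noteq> {}" for X Y
    proof -
      have "(0::nat) < 3" "(1::nat) < 3" "(2::nat) < 3" by simp_all
      then show ?thesis using key[of X Y] by blast
    qed
    show "(\<Sum>i<3. \<Sum>j<3. card (?R i j X Y)) \<le> 16" for X Y
      using key[of X Y] le2[of 0 0 X Y] le2[of 0 1 X Y] le2[of 1 0 X Y] le2[of 1 2 X Y]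
        le2[of 2 1 X Y] le2[of 2 2 X Y]
      unfolding card_less_3_square_sum by linarith
  qed
qed

section \<open>Windows of lifted parabolas\<close>

lemma div_less_int:
  fixes a b k :: int
  assumes "0 < b" "a < k * b"
  shows "a div b < k"
proof -
  have "a div b * b \<le> a"
    using assms by (simp add: minus_mod_eq_div_mult[symmetric])
  then have "a div b * b < k * b"
    using assms by linarith
  then show ?thesis
    using assms by simp
qed

lemma card_arith_progression_le:
  fixes a b r P :: int
  assumes "0 < P" "b - a \<le> int k * P"
  shows "card {x\<in>{a..<b}. P dvd x - r} \<le> k"
proof -
  let ?S = "{x\<in>{a..<b}. P dvd x - r}"
  have "inj_on (\<lambda>x. (x - a) div P) ?S"
  proof (rule inj_onI)
    fix x y assume "x \<in> ?S" "y \<in> ?S" and eq: "(x - a) div P = (y - a) div P"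
    then have "P dvd x - r" "P dvd y - r"
      by auto
    from dvd_diff[OF this] have "P dvd x - y"
      by simp
    then have "(x - a) mod P = (y - a) mod P"
      by (simp add: mod_eq_dvd_iff)
    then show "x = y"
      using eq by (metis add_diff_cancel_right' diff_add_cancel mult_div_mod_eq)
  qed
  then have "card ?S = card ((\<lambda>x. (x - a) div P) ` ?S)"
    by (simp add: card_image)
  also have "\<dots> \<le> card {0..<int k}"
  proof (intro card_mono subsetI)
    fix t assume "t \<in> (\<lambda>x. (x - a) div P) ` ?S"
    then obtain x where x: "x \<in> ?S" "t = (x - a) div P" by blast
    then have "x - a < int k * P" using assms by simp
    then have "t < int k"
      unfolding x(2) using \<open>0 < P\<close> by (intro div_less_int)
    then show "t \<in> {0..<int k}"
      using x assms by (simp add: pos_imp_zdiv_nonneg_iff)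
  qed simp
  finally show ?thesis by simp
qed

lemma exists_arith_progression:
  fixes a b r P :: int
  assumes "0 < P" "P \<le> b - a"
  shows "\<exists>x\<in>{a..<b}. P dvd x - r"
proof -
  have "(r - a) mod P < P" "0 \<le> (r - a) mod P"
    using assms by simp_all
  moreover have "P dvd a + (r - a) mod P - r"
  proof -
    have "P dvd - ((r - a) - (r - a) mod P)"
      unfolding dvd_minus_iff by (rule dvd_minus_mod)
    then show ?thesis
      by (simp add: algebra_simps)
  qed
  ultimately show ?thesis
    using assms(2) by (intro bexI[of _ "a + (r - a) mod P"]) (simp_all del: pos_mod_bound)
qed

definition conic_window :: "int \<Rightarrow> (nat \<Rightarrow> int) \<Rightarrow> int \<Rightarrow> int \<Rightarrow> (int \<times> int) set" where
  "conic_window P c L M = {(x, y). x \<in> {0..<L} \<and> y \<in> {0..<M} \<and> (\<exists>i<3. P dvd y - c i * x\<^sup>2)}"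

text \<open>An ordered pair of window points with sum \<open>(X, Y)\<close> is encoded by its first
  member, the second being determined by it.\<close>

definition window_reps :: "int \<Rightarrow> (nat \<Rightarrow> int) \<Rightarrow> int \<Rightarrow> int \<Rightarrow> int \<Rightarrow> int \<Rightarrow> (int \<times> int) set" where
  "window_reps P c L M X Y = {(x, y). (x, y) \<in> conic_window P c L M \<and> (X - x, Y - y) \<in> conic_window P c L M}"

lemma finite_conic_window: "finite (conic_window P c L M)"
  by (rule finite_subset[of _ "{0..<L} \<times> {0..<M}"]) (auto simp: conic_window_def)

lemma finite_window_reps: "finite (window_reps P c L M X Y)"
  by (rule finite_subset[OF _ finite_conic_window[of P c L M]]) (auto simp: window_reps_def)

lemma dvd_conic_reduce:
  fixes P x x0 :: int
  assumes "P dvd x - x0" "P dvd y - c * x\<^sup>2"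
  shows "P dvd y - c * x0\<^sup>2"
proof -
  have "P dvd (y - c * x\<^sup>2) + c * (x + x0) * (x - x0)"
    using assms by (intro dvd_add) simp_all
  also have "(y - c * x\<^sup>2) + c * (x + x0) * (x - x0) = y - c * x0\<^sup>2"
    by (simp add: power2_eq_square algebra_simps)
  finally show ?thesis .
qed

text \<open>A representation reduces to a root \<open>x0\<close> of one of nine conics, and the root
  fixes \<open>x\<close> and \<open>y\<close> modulo \<open>P\<close>. The admissible
  \<open>x\<close> fill an interval of length \<open>min (X + 1) (2 * L - 1 - X)\<close> (empty if
  this is negative), with at most \<open>k\<close> members in each class; likewise \<open>l\<close>
  for \<open>y\<close>.\<close>

lemma card_window_reps_le:
  fixes P :: int
  assumes P: "0 < P"
    and sum: "(\<Sum>i<3. \<Sum>j<3. card (conic_roots P (c i) (c j) X Y)) \<le> 16"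
    and k: "min (X + 1) (2 * L - 1 - X) \<le> int k * P"
    and l: "min (Y + 1) (2 * M - 1 - Y) \<le> int l * P"
  shows "card (window_reps P c L M X Y) \<le> 16 * (k * l)"
proof -
  let ?H = "\<lambda>L X r. {x\<in>{max 0 (X - L + 1)..<min L (X + 1)}. P dvd x - r}"
  let ?R = "\<lambda>i j. conic_roots P (c i) (c j) X Y"
  let ?U = "\<lambda>i j. \<Union>x0\<in>?R i j. ?H L X x0 \<times> ?H M Y (c i * x0\<^sup>2)"
  have H: "card (?H L X r) \<le> k" if "min (X + 1) (2 * L - 1 - X) \<le> int k * P" for L X r :: int and k
  proof (rule card_arith_progression_le[OF P])
    have "min L (X + 1) - max 0 (X - L + 1) \<le> min (X + 1) (2 * L - 1 - X)"
      by (auto simp: min_def max_def)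
    then show "min L (X + 1) - max 0 (X - L + 1) \<le> int k * P"
      using that by linarith
  qed
  have "window_reps P c L M X Y \<subseteq> (\<Union>i<3. \<Union>j<3. ?U i j)"
  proof
    fix w assume w: "w \<in> window_reps P c L M X Y"
    obtain x y where xy: "w = (x, y)" by (cases w)
    obtain i j where ij: "i < 3" "j < 3" "P dvd y - c i * x\<^sup>2" "P dvd (Y - y) - c j * (X - x)\<^sup>2"
      using w unfolding xy window_reps_def conic_window_def by auto
    define x0 where "x0 = x mod P"
    have x0: "P dvd x - x0" unfolding x0_def by (simp add: dvd_minus_mod)
    have y: "P dvd y - c i * x0\<^sup>2"
      using dvd_conic_reduce[OF x0 ij(3)] .
    have "P dvd (X - x) - (X - x0)"
      using x0 by (metis diff_diff_eq2 diff_add_cancel dvd_diff_commute add_diff_cancel_left' add.commute diff_diff_add)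
    from dvd_conic_reduce[OF this ij(4)] have "P dvd - ((y - c i * x0\<^sup>2) + ((Y - y) - c j * (X - x0)\<^sup>2))"
      using y by (simp only: dvd_minus_iff dvd_add)
    also have "- ((y - c i * x0\<^sup>2) + ((Y - y) - c j * (X - x0)\<^sup>2)) = c i * x0\<^sup>2 + c j * (X - x0)\<^sup>2 - Y"
      by simp
    finally have "x0 \<in> ?R i j"
      using P pos_mod_bound[OF P, of x] pos_mod_sign[OF P, of x] by (simp add: conic_roots_def x0_def)
    moreover have "w \<in> ?H L X x0 \<times> ?H M Y (c i * x0\<^sup>2)"
      using w x0 y unfolding xy window_reps_def conic_window_def by auto
    ultimately show "w \<in> (\<Union>i<3. \<Union>j<3. ?U i j)"
      using ij by blast
  qed
  then have "card (window_reps P c L M X Y) \<le> card (\<Union>i<3. \<Union>j<3. ?U i j)"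
    by (intro card_mono finite_UN_I finite_cartesian_product) simp_all
  also have "\<dots> \<le> (\<Sum>i<3. card (\<Union>j<3. ?U i j))"
    by (rule card_UN_le) simp
  also have "\<dots> \<le> (\<Sum>i<3. \<Sum>j<3. card (?U i j))"
    by (intro sum_mono card_UN_le) simp
  also have "\<dots> \<le> (\<Sum>i<3. \<Sum>j<3. card (?R i j) * (k * l))"
  proof (intro sum_mono)
    fix i j :: nat
    have "card (?U i j) \<le> (\<Sum>x0\<in>?R i j. card (?H L X x0 \<times> ?H M Y (c i * x0\<^sup>2)))"
      by (rule card_UN_le) simp
    also have "\<dots> \<le> (\<Sum>x0\<in>?R i j. k * l)"
      unfolding card_cartesian_product by (intro sum_mono mult_mono H k l) simp_all
    finally show "card (?U i j) \<le> card (?R i j) * (k * l)"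
      by simp
  qed
  also have "\<dots> = (\<Sum>i<3. \<Sum>j<3. card (?R i j)) * (k * l)"
    by (simp only: sum_distrib_right)
  also have "\<dots> \<le> 16 * (k * l)"
    using sum by (rule mult_right_mono) simp
  finally show ?thesis .
qed

text \<open>The hypotheses make both admissible intervals at least \<open>P\<close> long, so they
  meet every class modulo \<open>P\<close> and any root lifts.\<close>

lemma window_reps_nonempty:
  fixes P :: int
  assumes P: "0 < P"
    and root: "\<exists>i<3. \<exists>j<3. conic_roots P (c i) (c j) X Y \<noteq> {}"
    and L: "P \<le> L" "P \<le> X + 1" "P \<le> 2 * L - 1 - X"
    and M: "P \<le> M" "P \<le> Y + 1" "P \<le> 2 * M - 1 - Y"
  shows "window_reps P c L M X Y \<noteq> {}"
proof -
  obtain i j x0 where ij: "i < 3" "j < 3" "x0 \<in> conic_roots P (c i) (c j) X Y"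
    using root by blast
  have ex: "\<exists>x\<in>{max 0 (X - L + 1)..<min L (X + 1)}. P dvd x - r"
    if "P \<le> L" "P \<le> X + 1" "P \<le> 2 * L - 1 - X" for L X r :: int
    by (rule exists_arith_progression[OF P]) (use that in auto)
  obtain x where x: "x \<in> {max 0 (X - L + 1)..<min L (X + 1)}" "P dvd x - x0"
    using ex[OF L] by blast
  obtain y where y: "y \<in> {max 0 (Y - M + 1)..<min M (Y + 1)}" "P dvd y - c i * x0\<^sup>2"
    using ex[OF M] by blast
  have x': "P dvd x0 - x"
    using x(2) by (simp add: dvd_diff_commute)
  have "P dvd - ((y - c i * x0\<^sup>2) + (c i * x0\<^sup>2 + c j * (X - x0)\<^sup>2 - Y))"
    using y(2) ij(3) unfolding dvd_minus_iff by (intro dvd_add) (simp_all add: conic_roots_def)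
  also have "- ((y - c i * x0\<^sup>2) + (c i * x0\<^sup>2 + c j * (X - x0)\<^sup>2 - Y)) = (Y - y) - c j * (X - x0)\<^sup>2"
    by simp
  finally have *: "P dvd (Y - y) - c j * (X - x0)\<^sup>2" .
  have "P dvd (X - x0) - (X - x)"
    using x(2) by simp
  from dvd_conic_reduce[OF this *] have "P dvd (Y - y) - c j * (X - x)\<^sup>2" .
  moreover have "P dvd y - c i * x\<^sup>2"
    using dvd_conic_reduce[OF x' y(2)] .
  ultimately have "(x, y) \<in> window_reps P c L M X Y"
    using x y ij by (auto simp: window_reps_def conic_window_def)
  then show ?thesis by blast
qed

text \<open>\<open>(X, Y)\<close> and \<open>(X + N, Y - 1)\<close> have the same image under \<open>x + N y\<close>; in the \<open>x\<close>-coordinate their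
  numbers of lifts total at most 3.\<close>

lemma card_two_window_reps_le:
  fixes P L M N X Y :: int
  assumes P: "0 < P" and N: "2 * L \<le> 2 * P + N" "N \<le> 4 * P"
    and sum: "\<And>X Y. (\<Sum>i<3. \<Sum>j<3. card (conic_roots P (c i) (c j) X Y)) \<le> 16"
    and X: "0 \<le> X"
    and Y: "min (Y + 1) (2 * M - Y) \<le> int b * P"
  shows "card (window_reps P c L M X Y) + card (window_reps P c L M (X + N) (Y - 1)) \<le> 48 * b"
proof -
  have bound: "card (window_reps P c L M X Y) + card (window_reps P c L M (X + N) (Y - 1)) \<le> 48 * b"
    if "min (X + 1) (2 * L - 1 - X) \<le> int k1 * P" "2 * L - 1 - (X + N) \<le> int k2 * P" "k1 + k2 \<le> 3" for k1 k2
  proof -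
    \<comment> \<open>The bound with \<open>2 * M - Y\<close> is loose by one so that it serves both
      second coordinates \<open>Y\<close> and \<open>Y - 1\<close>.\<close>
    have "min (Y + 1) (2 * M - 1 - Y) \<le> int b * P" "min (Y - 1 + 1) (2 * M - 1 - (Y - 1)) \<le> int b * P"
      using Y by linarith+
    moreover have "min (X + N + 1) (2 * L - 1 - (X + N)) \<le> int k2 * P"
      using that by linarith
    ultimately have "card (window_reps P c L M X Y) \<le> 16 * (k1 * b)"
      "card (window_reps P c L M (X + N) (Y - 1)) \<le> 16 * (k2 * b)"
      using that(1) by (blast intro: card_window_reps_le[OF P sum])+
    then have "card (window_reps P c L M X Y) + card (window_reps P c L M (X + N) (Y - 1)) \<le> 16 * ((k1 + k2) * b)"
      by (simp add: algebra_simps)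
    also have "\<dots> \<le> 16 * (3 * b)"
      using that by (intro mult_left_mono mult_right_mono) simp_all
    finally show ?thesis by simp
  qed
  \<comment> \<open>The lift counts are 1 + 2, 2 + 1 and 3 + 0. In the last case the terms of the
    minimum add up to \<open>2 * L\<close>, so it is at most \<open>L <= 3 * P\<close>, and the
    translate by \<open>N\<close> has no lifts.\<close>
  consider "X < P" | "P \<le> X" "X < 2 * P" | "2 * P \<le> X"
    by linarith
  then show ?thesis
  proof cases
    case 1
    then show ?thesis using X N P by (intro bound[of 1 2]) auto
  next
    case 2
    then show ?thesis using X N P by (intro bound[of 2 1]) auto
  next
    case 3
    then show ?thesis using X N P by (intro bound[of 3 0]) auto
  qed
qed

section \<open>Additive bases of residue rings\<close>

lemma rep_count_pos:
  assumes "A \<subseteq> {0..<m}" "a \<in> A" "a' \<in> A" "[a + a' = n] (mod m)"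
  shows "1 \<le> rep_count m A n"
proof -
  let ?S = "{(a, a'). a \<in> A \<and> a' \<in> A \<and> [a + a' = n] (mod m)}"
  have "finite A"
    using assms(1) finite_subset by blast
  then have "finite ?S"
    by (intro finite_subset[of ?S "A \<times> A"]) auto
  moreover have "(a, a') \<in> ?S"
    using assms by simp
  ultimately have "0 < card ?S"
    by (subst card_gt_0_iff) blast
  then show ?thesis
    by (simp add: rep_count_def)
qed

lemma exists_basis_of_prime:
  fixes p N h m r :: nat
  assumes p: "prime p" "11 \<le> p"
    and h: "p \<le> h" "h \<le> 2 * p"
    and N: "2 * p \<le> N" "N \<le> 4 * p"
    and m: "m = N * (2 * h) + r" "r < N"
  shows "\<exists>A\<subseteq>{0..<m}. \<forall>n\<in>{0..<m}. 1 \<le> rep_count m A n \<and> rep_count m A n \<le> 144"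
proof -
  obtain c :: "nat \<Rightarrow> int" where c: "\<And>X Y. \<exists>i<3. \<exists>j<3. conic_roots (int p) (c i) (c j) X Y \<noteq> {}"
    "\<And>X Y. (\<Sum>i<3. \<Sum>j<3. card (conic_roots (int p) (c i) (c j) X Y)) \<le> 16"
    by (rule exists_three_conics[OF p]) (rule that)
  define P where "P = int p"
  \<comment> \<open>With these sizes the sums all of whose residue classes are met include
    \<open>N\<close> consecutive values of \<open>X\<close> and \<open>2 * h + 1\<close> of
    \<open>Y\<close>; rounding down \<open>N div 2\<close> still leaves enough.\<close>
  define L where "L = P + int N div 2"
  define M where "M = P + int h"
  define W where "W = conic_window P c L M"
  define \<rho> where "\<rho> = window_reps P c L M"
  define \<psi> where "\<psi> = (\<lambda>(x, y). nat ((x + int N * y) mod int m))"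
  define A where "A = \<psi> ` W"
  have P: "0 < P" using p by (simp add: P_def)
  have "0 < m" "0 < N" using m N p h by auto
  have cP: "\<exists>i<3. \<exists>j<3. conic_roots P (c i) (c j) X Y \<noteq> {}"
    "(\<Sum>i<3. \<Sum>j<3. card (conic_roots P (c i) (c j) X Y)) \<le> 16" for X Y
    unfolding P_def by (rule c)+
  have L: "2 * P + int N - 1 \<le> 2 * L" "2 * L \<le> 2 * P + int N"
    unfolding L_def by presburger+
  have M: "2 * M = 2 * P + int (2 * h)"
    by (simp add: M_def)
  have int_\<psi>: "[int (\<psi> (x, y)) = x + int N * y] (mod int m)" for x y
    using \<open>0 < m\<close> by (simp add: \<psi>_def cong_def)
  have fin: "finite (\<rho> X Y)" for X Y
    unfolding \<rho>_def by (rule finite_window_reps)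
  have in_W: "(x, y) \<in> W" "(X - x, Y - y) \<in> W" if "(x, y) \<in> \<rho> X Y" for x y X Y
    using that by (auto simp: \<rho>_def window_reps_def W_def)
  \<comment> \<open>Lifts may collide under \<psi>, so these images bound the number of pairs of
    residues only from above.\<close>
  define G where "G X Y = (\<lambda>(x, y). (\<psi> (x, y), \<psi> (X - x, Y - y))) ` \<rho> X Y" for X Y
  have sub: "A \<subseteq> {0..<m}"
    using \<open>0 < m\<close> by (auto simp: A_def \<psi>_def nat_less_iff)
  have lower: "1 \<le> rep_count m A n" for n
  proof -
    \<comment> \<open>The image of the corner \<open>(P - 1, P - 1)\<close>, where full coverage
      begins. The residue of \<open>n - V0\<close> is then written in base \<open>N\<close>; since
      \<open>m < (2 * h + 1) * N\<close>, its quotient is at most \<open>2 * h\<close>.\<close>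
    define V0 where "V0 = (P - 1) * (int N + 1)"
    define k where "k = (int n - V0) mod int m"
    define X where "X = P - 1 + k mod int N"
    define Y where "Y = P - 1 + k div int N"
    have k: "0 \<le> k" "k < int m"
      using \<open>0 < m\<close> by (simp_all add: k_def)
    have "k < int (2 * h + 1) * int N"
      using k m by (simp add: algebra_simps flip: of_nat_add of_nat_mult)
    then have "k div int N < int (2 * h + 1)"
      using \<open>0 < N\<close> by (intro div_less_int) simp_all
    then have Y: "P - 1 \<le> Y" "Y \<le> P - 1 + int (2 * h)"
      using k \<open>0 < N\<close> by (simp_all add: Y_def pos_imp_zdiv_nonneg_iff)
    have X: "P - 1 \<le> X" "X \<le> P - 2 + int N"
      using \<open>0 < N\<close> pos_mod_bound[of "int N" k] unfolding X_def by (simp, linarith)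
    have "\<rho> X Y \<noteq> {}"
      unfolding \<rho>_def
    proof (rule window_reps_nonempty[OF P cP(1)])
      show "P \<le> L" "P \<le> M" by (simp_all add: L_def M_def)
      show "P \<le> X + 1" "P \<le> Y + 1" using X Y by simp_all
      show "P \<le> 2 * L - 1 - X" using X L by linarith
      show "P \<le> 2 * M - 1 - Y" using Y M by linarith
    qed
    then obtain x y where xy: "(x, y) \<in> \<rho> X Y"
      by auto
    have "[int (\<psi> (x, y)) + int (\<psi> (X - x, Y - y)) = (x + int N * y) + (X - x + int N * (Y - y))] (mod int m)"
      by (intro cong_add int_\<psi>)
    also have "(x + int N * y) + (X - x + int N * (Y - y)) = X + int N * Y"
      by (simp add: algebra_simps)
    also have "X + int N * Y = V0 + (int N * (k div int N) + k mod int N)"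
      by (simp add: X_def Y_def V0_def algebra_simps)
    also have "\<dots> = V0 + k"
      by simp
    also have "[V0 + k = V0 + (int n - V0)] (mod int m)"
      unfolding k_def by (intro cong_add) simp_all
    finally have "[\<psi> (x, y) + \<psi> (X - x, Y - y) = n] (mod m)"
      by (simp flip: cong_int_iff)
    then show ?thesis
      using in_W[OF xy] by (intro rep_count_pos[OF sub]) (simp_all add: A_def)
  qed
  have upper: "rep_count m A n \<le> 144" if n: "n \<in> {0..<m}" for n
  proof -
    \<comment> \<open>\<open>?U V\<close> contains all representations with \<open>X + N Y = V\<close>.\<close>
    let ?U = "\<lambda>V. G (V mod int N) (V div int N) \<union> G (V mod int N + int N) (V div int N - 1)"
    have "{(a, a'). a \<in> A \<and> a' \<in> A \<and> [a + a' = n] (mod m)} \<subseteq> ?U (int n) \<union> ?U (int n + int m)"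
    proof (rule subsetI)
      fix z assume "z \<in> {(a, a'). a \<in> A \<and> a' \<in> A \<and> [a + a' = n] (mod m)}"
      then obtain a a' where z: "z = (a, a')" and a: "a \<in> A" "a' \<in> A" and cong: "[a + a' = n] (mod m)"
        by blast
      obtain x y x' y' where xy: "(x, y) \<in> W" "(x', y') \<in> W" "a = \<psi> (x, y)" "a' = \<psi> (x', y')"
        using a unfolding A_def by auto
      define X where "X = x + x'"
      define Y where "Y = y + y'"
      define V where "V = X + int N * Y"
      have bounds: "0 \<le> X" "X \<le> 2 * L - 2" "0 \<le> Y" "Y \<le> 2 * M - 2"
        using xy by (auto simp: X_def Y_def W_def conic_window_def)
      have "(a, a') = (\<lambda>(x, y). (\<psi> (x, y), \<psi> (X - x, Y - y))) (x, y)"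
        by (simp add: xy X_def Y_def)
      moreover have "(x, y) \<in> \<rho> X Y"
        using xy by (simp add: \<rho>_def window_reps_def X_def Y_def W_def)
      ultimately have inG: "(a, a') \<in> G X Y"
        unfolding G_def by blast
      \<comment> \<open>This is where \<open>2 * p <= N\<close> enters: a given value of
        \<open>V\<close> leaves only two possible positions \<open>(X, Y)\<close>.\<close>
      have X2: "X < 2 * int N"
        using bounds L N by (simp add: P_def)
      have inU: "(a, a') \<in> ?U V"
      proof (cases "X < int N")
        case True
        then have "V mod int N = X" "V div int N = Y"
          using bounds \<open>0 < N\<close> by (simp_all add: V_def)
        then show ?thesis using inG by simp
      next
        case False
        have V: "V = int N * (Y + 1) + (X - int N)"
          by (simp add: V_def algebra_simps)
        have "V mod int N = X - int N" "V div int N = Y + 1"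
          using False X2 by (intro int_mod_pos_eq[OF V] int_div_pos_eq[OF V]; simp)+
        then show ?thesis using inG by simp
      qed
      have "[x + int N * y + (x' + int N * y') = int (\<psi> (x, y)) + int (\<psi> (x', y'))] (mod int m)"
        by (intro cong_add cong_sym[OF int_\<psi>])
      also have "[int (\<psi> (x, y)) + int (\<psi> (x', y')) = int n] (mod int m)"
        using cong unfolding xy by (simp flip: cong_int_iff)
      finally have "[V = int n] (mod int m)"
        by (simp add: V_def X_def Y_def algebra_simps)
      then have "V mod int m = int n"
        using n by (simp add: cong_def)
      then have V: "V = int n + int m * (V div int m)"
        by (metis mod_mult_div_eq)
      have "0 \<le> V"
        using bounds by (simp add: V_def)
      \<comment> \<open>By \<open>p <= h\<close>, the sums of images stay below
        \<open>2 * m\<close>, so only \<open>n\<close> and \<open>n + m\<close> occur as values of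
        \<open>V\<close>.\<close>
      have "V < 2 * int m"
      proof -
        have "Y \<le> 2 * int (2 * h) - 2"
          using bounds M h by (simp add: P_def)
        then have "int N * Y \<le> int N * (2 * int (2 * h) - 2)"
          by (rule mult_left_mono) simp
        then have "V < 2 * int N + int N * (2 * int (2 * h) - 2)"
          using X2 by (simp add: V_def)
        also have "\<dots> \<le> 2 * int m"
          by (simp add: m algebra_simps)
        finally show ?thesis .
      qed
      then have "V div int m < 2" "0 \<le> V div int m"
        using \<open>0 \<le> V\<close> \<open>0 < m\<close> by (simp_all add: div_less_int pos_imp_zdiv_nonneg_iff)
      then have "V div int m = 0 \<or> V div int m = 1"
        by linarith
      then have "V = int n \<or> V = int n + int m"
        using V by (metis add.right_neutral mult.right_neutral mult_zero_right)
      then show "z \<in> ?U (int n) \<union> ?U (int n + int m)"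
        using inU z by blast
    qed
    then have "rep_count m A n \<le> card (?U (int n) \<union> ?U (int n + int m))"
      unfolding rep_count_def by (rule card_mono[rotated]) (simp add: G_def fin)
    also have "\<dots> \<le> card (?U (int n)) + card (?U (int n + int m))"
      by (rule card_Un_le)
    finally have le: "rep_count m A n \<le> card (?U (int n)) + card (?U (int n + int m))" .
    have U: "card (?U V) \<le> 48 * b"
      if "min (V div int N + 1) (2 * M - V div int N) \<le> int b * P" for V b
    proof -
      have "card (?U V) \<le> card (G (V mod int N) (V div int N)) + card (G (V mod int N + int N) (V div int N - 1))"
        by (rule card_Un_le)
      also have "\<dots> \<le> card (\<rho> (V mod int N) (V div int N)) + card (\<rho> (V mod int N + int N) (V div int N - 1))"
        unfolding G_def by (intro add_mono card_image_le fin)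
      also have "\<dots> \<le> 48 * b"
        unfolding \<rho>_def
        by (rule card_two_window_reps_le[OF P L(2) _ cP(2) _ that]) (use N \<open>0 < N\<close> in \<open>simp_all add: P_def\<close>)
      finally show ?thesis .
    qed
    let ?Q = "int n div int N" and ?Q' = "(int n + int m) div int N"
    have Q0: "0 \<le> ?Q"
      using \<open>0 < N\<close> by (simp add: pos_imp_zdiv_nonneg_iff)
    have "?Q + int (2 * h) = (int n + int N * int (2 * h)) div int N"
      using \<open>0 < N\<close> by simp
    also have "\<dots> \<le> ?Q'"
      using \<open>0 < N\<close> m by (intro zdiv_mono1) simp_all
    finally have Q': "?Q + int (2 * h) \<le> ?Q'" .
    have sum: "rep_count m A n \<le> 144"
      if "min (?Q + 1) (2 * M - ?Q) \<le> int b * P" "2 * M - ?Q' \<le> int b' * P" "b + b' \<le> 3" for b b'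
    proof -
      have "min (?Q' + 1) (2 * M - ?Q') \<le> int b' * P"
        using that by linarith
      from U[OF this] U[OF that(1)] le \<open>b + b' \<le> 3\<close> show ?thesis
        by linarith
    qed
    have hP: "int h \<le> 2 * P" using h by (simp add: P_def)
    \<comment> \<open>The count 1 + 2, 2 + 1, 3 + 0 again, now for the second coordinate, where the
      quotients are at least \<open>2 * h\<close> apart. In the last case the terms of the minimum
      add up to \<open>2 * M + 1\<close>, so it is at most \<open>M = P + h <= 3 * P\<close>. The
      total is 48 * 3 = 144.\<close>
    consider "?Q < P" | "P \<le> ?Q" "?Q < 2 * P" | "2 * P \<le> ?Q"
      by linarith
    then show ?thesis
    proof cases
      case 1
      then show ?thesis using Q' Q0 M P by (intro sum[of 1 2]) auto
    next
      case 2
      then show ?thesis using Q' Q0 M P by (intro sum[of 2 1]) auto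
    next
      case 3
      then show ?thesis using Q' Q0 M P hP by (intro sum[of 3 0]) auto
    qed
  qed
  show ?thesis
    using sub lower upper by blast
qed

lemma exists_basis_large:
  fixes m :: nat
  assumes "5000 \<le> m"
  shows "\<exists>A\<subseteq>{0..<m}. \<forall>n\<in>{0..<m}. 1 \<le> rep_count m A n \<and> rep_count m A n \<le> 144"
proof -
  define s where "s = floor_sqrt m"
  define h where "h = s div 2"
  define N where "N = m div (2 * h)"
  have s1: "s\<^sup>2 \<le> m" and s2: "m < (s + 1)\<^sup>2"
    unfolding s_def using Suc_floor_sqrt_power2_gt by simp_all
  \<comment> \<open>This yields \<open>(h + 1) div 2 >= 18\<close>, within the range of
    \<open>bertrand\<close>.\<close>
  have "70 \<le> s"
    unfolding s_def using assms by (intro le_floor_sqrtI) simp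
  then have h: "35 \<le> h" "2 * h \<le> s" "s \<le> 2 * h + 1"
    unfolding h_def by linarith+
  obtain p where p: "prime p" "(h + 1) div 2 < p" "p \<le> 2 * ((h + 1) div 2)"
  proof -
    have "12 \<le> (h + 1) div 2" using h by linarith
    from bertrand[OF this] that show ?thesis by blast
  qed
  \<comment> \<open>Parity excludes the upper end of Bertrand's interval, which improves
    \<open>p <= h + 1\<close> to \<open>p <= h\<close>.\<close>
  have "p \<noteq> 2 * ((h + 1) div 2)"
  proof -
    have "2 < p" using p(2) h by linarith
    then have "odd p" using p(1) prime_odd_nat by blast
    then show ?thesis by auto
  qed
  then have ph: "p \<le> h" "h + 2 \<le> 2 * p"
    using p by linarith+
  have "(2 * h)\<^sup>2 \<le> m"
    using power_mono[OF h(2), of 2] s1 by linarith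
  then have N1: "2 * h \<le> N"
    using h by (simp add: N_def power2_eq_square less_eq_div_iff_mult_less_eq)
  have "(s + 1)\<^sup>2 \<le> (2 * h + 2)\<^sup>2"
    using h by (intro power_mono) simp_all
  \<comment> \<open>The constant 5 gives \<open>N <= 2 * h + 4\<close>, which is at most
    \<open>4 * p\<close> because \<open>h + 2 <= 2 * p\<close>.\<close>
  also have "\<dots> \<le> (2 * h + 5) * (2 * h)"
    using h by (simp add: power2_eq_square algebra_simps)
  finally have "m < (2 * h + 5) * (2 * h)"
    using s2 by linarith
  then have N2: "N < 2 * h + 5"
    unfolding N_def by (rule less_mult_imp_div_less)
  have "m mod (2 * h) < 2 * h"
    using h by simp
  show ?thesis
  proof (rule exists_basis_of_prime)
    show "m = N * (2 * h) + m mod (2 * h)"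
      unfolding N_def by (rule div_mult_mod_eq[symmetric])
    show "m mod (2 * h) < N"
      using N1 \<open>m mod (2 * h) < 2 * h\<close> by linarith
    show "11 \<le> p" "h \<le> 2 * p" "2 * p \<le> N" "N \<le> 4 * p"
      using h ph N1 N2 by linarith+
  qed (use p ph in auto)
qed

section \<open>Small moduli\<close>

lemma rep_count_le_card:
  assumes "A \<subseteq> {0..<m}"
  shows "rep_count m A n \<le> card A"
proof -
  let ?S = "{(a, a'). a \<in> A \<and> a' \<in> A \<and> [a + a' = n] (mod m)}"
  have finA: "finite A"
    using assms finite_subset by blast
  \<comment> \<open>The first summand determines the second modulo \<open>m\<close>, hence exactly,
    as both candidates lie below \<open>m\<close>.\<close>
  have "inj_on fst ?S"
  proof (rule inj_onI)
    fix u v assume "u \<in> ?S" "v \<in> ?S" "fst u = fst v"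
    then obtain a b b' where uv: "u = (a, b)" "v = (a, b')" and "b \<in> A" "b' \<in> A"
      and "[a + b = n] (mod m)" "[a + b' = n] (mod m)"
      by auto
    then have "[a + b = a + b'] (mod m)"
      using cong_sym cong_trans by blast
    then have "[b = b'] (mod m)"
      by (simp add: cong_add_lcancel_nat)
    moreover have "b < m" "b' < m"
      using assms \<open>b \<in> A\<close> \<open>b' \<in> A\<close> by auto
    ultimately show "u = v"
      unfolding uv using cong_less_modulus_unique_nat by blast
  qed
  then show ?thesis
    unfolding rep_count_def using finA by (intro card_inj_on_le[of fst]) auto
qed

text \<open>The set consists of the base \<open>k\<close> digits and their multiples by
  \<open>k\<close>, reduced modulo \<open>m\<close> because they may exceed it; \<open>n\<close> is
  the sum of \<open>n mod k\<close> and \<open>n div k * k\<close>.\<close>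

lemma exists_basis_small:
  fixes m k :: nat
  assumes "0 < m" "m \<le> k * k"
  shows "\<exists>A\<subseteq>{0..<m}. \<forall>n\<in>{0..<m}. 1 \<le> rep_count m A n \<and> rep_count m A n \<le> 2 * k"
proof -
  define A where "A = (\<lambda>i. i mod m) ` ({0..<k} \<union> (\<lambda>i. i * k) ` {0..<k})"
  have sub: "A \<subseteq> {0..<m}"
    using assms by (auto simp: A_def)
  have "card A \<le> card ({0..<k} \<union> (\<lambda>i. i * k) ` {0..<k})"
    unfolding A_def by (rule card_image_le) simp
  also have "\<dots> \<le> card {0..<k} + card ((\<lambda>i. i * k) ` {0..<k})"
    by (rule card_Un_le)
  also have "\<dots> \<le> card {0..<k} + card {0..<k}"
    by (intro add_left_mono card_image_le) simp
  finally have cardA: "card A \<le> 2 * k" by simp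
  have "1 \<le> rep_count m A n" if n: "n \<in> {0..<m}" for n
  proof -
    have "0 < k" using assms by (cases k) auto
    have "n div k < k"
      using n assms by (intro less_mult_imp_div_less) simp
    then have "n mod k \<in> {0..<k}" "n div k * k \<in> (\<lambda>i. i * k) ` {0..<k}"
      using \<open>0 < k\<close> by simp_all
    then have "(n mod k) mod m \<in> A" "(n div k * k) mod m \<in> A"
      unfolding A_def by blast+
    moreover have "[(n mod k) mod m + (n div k * k) mod m = n] (mod m)"
      by (simp add: cong_def mod_simps)
    ultimately show ?thesis
      by (intro rep_count_pos[OF sub])
  qed
  moreover have "rep_count m A n \<le> 2 * k" for n
    using rep_count_le_card[OF sub, of n] cardA by linarith
  ultimately show ?thesis
    using sub by blast
qed

lemma ruzsa_number_le_144:
  assumes "0 < m"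
  shows "ruzsa_number m \<le> 144"
proof -
  have "\<exists>A\<subseteq>{0..<m}. \<forall>n\<in>{0..<m}. 1 \<le> rep_count m A n \<and> rep_count m A n \<le> 144"
  proof (cases "5000 \<le> m")
    case True
    then show ?thesis by (rule exists_basis_large)
  next
    case False
    \<comment> \<open>Here 72 * 72 = 5184 covers every modulus below 5000, and 2 * 72 = 144.\<close>
    then show ?thesis using exists_basis_small[of m 72] assms by simp
  qed
  then show ?thesis
    unfolding ruzsa_number_def by (rule Least_le)
qed

theorem theorem1:
  fixes m :: nat
  assumes "m > 0"
  shows "\<bar>int (ruzsa_number (m + 1)) - int (ruzsa_number m)\<bar> \<le> 144"
  using ruzsa_number_le_144[of m] ruzsa_number_le_144[of "m + 1"] assms by auto

end
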